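(* Let $0<r<\sqrt{2}$, consider a circular cylinder of radius $r$, and define $$L_0=\frac{\sqrt{8}\,\pi r}{\sqrt{2-r^2}}.$$ If $L>L_0$, then the compact piece $C_r(L)$ of length $L$ of the cylinder is unstable as a translating $\frac1r$-soliton (with respect to the density vector $\mathbf{v}=(0,0,1)$, the direction of the rulings).
   Context: Let $\mathbf{v}=(0,0,1)$ and $\phi(x)=\langle x,\mathbf{v}\rangle=x_3$; the weighted area element is $dA_\phi=e^{x_3}dA$. An oriented surface with Gauss map $N$ is a translating $\lambda$-soliton with respect to $\mathbf{v}$ if its mean curvature $H$ (sum of the principal curvatures, with sign convention $H=\mathrm{trace}(-dN)$) satisfies $H=\langle N,\mathbf{v}\rangle+\lambda$. For $r>0$ the circular cylinder $C_r$ is parametrized by $\Psi(s,t)=(r\cos(s/r),r\sin(s/r),t)$; with the inward unit normal it has $H=1/r$ and $\langle N,\mathbf{v}\rangle=0$, so it is a translating $\frac1r$-soliton with respect to $\mathbf{v}$. For $L>0$, $C_r(L)=\Psi(\mathbb{R}\times[0,L])$, a compact surface with boundary consisting of the two circles $t=0$ and $t=L$. Stability: for a smooth function $u$ on a compact translating $\lambda$-soliton $\Sigma$ vanishing on $\partial\Sigma$, the second variation of the weighted area for variations fixing the boundary with normal component $u$ is $Q_\phi(u)=-\int_\Sigma u(\Delta u+\langle\nabla u,\mathbf{v}\rangle+|A|^2u)\,dA_\phi=\int_\Sigma(|\nabla u|^2-|A|^2u^2)\,dA_\phi$, where $\Delta,\nabla$ are the Laplacian and gradient of $\Sigma$ and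 $A$ its second fundamental form. $\Sigma$ is stable if $Q_\phi(u)\ge0$ for all such $u$ with $\int_\Sigma u\,dA_\phi=0$ (volume preserving variations), and unstable if it is not stable, i.e. if there is such a $u$ with $u=0$ on $\partial\Sigma$, $\int_\Sigma u\,dA_\phi=0$ and $Q_\phi(u)<0$. *)

theory Defs
  imports "HOL-Analysis.Analysis"
begin

text \<open>Smooth maps on an open set of a Euclidean space: all iterated partial derivatives exist
  and are continuous.\<close>

primrec Ck_on :: "nat \<Rightarrow> 'a::euclidean_space set \<Rightarrow> ('a \<Rightarrow> 'b::real_normed_vector) \<Rightarrow> bool" where
  "Ck_on 0 U f \<longleftrightarrow> continuous_on U f"
| "Ck_on (Suc k) U f \<longleftrightarrow>
     (\<forall>x\<in>U. f differentiable at x) \<and>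
     (\<forall>b\<in>Basis. Ck_on k U (\<lambda>x. frechet_derivative f (at x) b))"

text \<open>A function on a (not necessarily open) set is smooth if it is smooth on an open
  neighbourhood. For an embedded compact surface with boundary every intrinsically smooth
  function has such an extension.\<close>

definition smooth_near :: "'a::euclidean_space set \<Rightarrow> ('a \<Rightarrow> 'b::real_normed_vector) \<Rightarrow> bool" where
  "smooth_near M f \<longleftrightarrow> (\<exists>U. open U \<and> M \<subseteq> U \<and> (\<forall>k. Ck_on k U f))"

text \<open>An oriented surface is presented by a parametrization \<open>chart\<close> of it over a plane region.
  The parametrization may wind around the surface; \<open>fund\<close> is a part of the region that covers
  every point of the surface exactly once and is used for integration. The Gauss map is a
  function of the point of space.\<close>

record psurface =
  chart :: "real \<times> real \<Rightarrow> real^3"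
  region :: "(real \<times> real) set"
  fund :: "(real \<times> real) set"
  gauss :: "real^3 \<Rightarrow> real^3"

definition points :: "psurface \<Rightarrow> (real^3) set" where
  "points S = chart S ` region S"

definition bdry :: "psurface \<Rightarrow> (real^3) set" where
  "bdry S = chart S ` frontier (region S)"

definition pd :: "2 \<Rightarrow> (real \<times> real \<Rightarrow> 'b::real_normed_vector) \<Rightarrow> real \<times> real \<Rightarrow> 'b" where
  "pd i f p = frechet_derivative f (at p) (if i = 1 then (1, 0) else (0, 1))"

definition first_form :: "psurface \<Rightarrow> real \<times> real \<Rightarrow> real^2^2" where
  "first_form S p = (\<chi> i j. pd i (chart S) p \<bullet> pd j (chart S) p)"

definition second_form :: "psurface \<Rightarrow> real \<times> real \<Rightarrow> real^2^2" where
  "second_form S p = (\<chi> i j. - (pd i (gauss S \<circ> chart S) p \<bullet> pd j (chart S) p))"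

text \<open>The matrix of \<open>-dN\<close> in the coordinate frame (Weingarten equations).\<close>

definition shape_op :: "psurface \<Rightarrow> real \<times> real \<Rightarrow> real^2^2" where
  "shape_op S p = matrix_inv (first_form S p) ** second_form S p"

definition mean_curv :: "psurface \<Rightarrow> real \<times> real \<Rightarrow> real" where
  "mean_curv S p = trace (shape_op S p)"

text \<open>\<open>|A|\<^sup>2\<close>: as \<open>-dN\<close> is self-adjoint, its squared Hilbert-Schmidt norm is the trace of its
  square, the sum of the squares of the principal curvatures.\<close>

definition sq_norm_A :: "psurface \<Rightarrow> real \<times> real \<Rightarrow> real" where
  "sq_norm_A S p = trace (shape_op S p ** shape_op S p)"

text \<open>\<open>|\<nabla>u|\<^sup>2 = g\<^sup>i\<^sup>j \<partial>\<^sub>iu \<partial>\<^sub>ju\<close> for the intrinsic gradient on the surface.\<close>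

definition sq_norm_grad :: "psurface \<Rightarrow> (real^3 \<Rightarrow> real) \<Rightarrow> real \<times> real \<Rightarrow> real" where
  "sq_norm_grad S u p =
     (let du = (\<chi> i. pd i (u \<circ> chart S) p) :: real^2
      in du \<bullet> (matrix_inv (first_form S p) *v du))"

text \<open>The chart condition \<open>open_map\<close> together with the immersion condition makes the chart a local
  homeomorphism onto the surface, so that the surface is embedded. When the region is a plane
  region with boundary (here, a strip), the boundary of the surface is the image of its frontier.\<close>

definition compact_surface :: "psurface \<Rightarrow> bool" where
  "compact_surface S \<longleftrightarrow>
     closed (region S) \<and> region S \<subseteq> closure (interior (region S)) \<and>
     smooth_near (region S) (chart S) \<and>
     (\<forall>p\<in>region S. det (first_form S p) \<noteq> 0) \<and>
     open_map (top_of_set (region S)) (top_of_set (points S)) (chart S) \<and>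
     compact (points S) \<and>
     fund S \<in> sets borel \<and> fund S \<subseteq> region S \<and>
     inj_on (chart S) (fund S) \<and> chart S ` fund S = points S \<and>
     smooth_near (points S) (gauss S) \<and>
     (\<forall>p\<in>region S. norm (gauss S (chart S p)) = 1 \<and>
        (\<forall>i. gauss S (chart S p) \<bullet> pd i (chart S) p = 0))"

definition translating_soliton :: "real^3 \<Rightarrow> real \<Rightarrow> psurface \<Rightarrow> bool" where
  "translating_soliton v lam S \<longleftrightarrow>
     compact_surface S \<and>
     (\<forall>p\<in>region S. mean_curv S p = gauss S (chart S p) \<bullet> v + lam)"

text \<open>Integral with respect to the weighted area \<open>e\<^sup>\<phi> dA\<close>, \<open>\<phi>(x) = \<langle>x, v\<rangle>\<close>, of a function
  given in the coordinates of the parametrization.\<close>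

definition weighted_integral :: "real^3 \<Rightarrow> psurface \<Rightarrow> (real \<times> real \<Rightarrow> real) \<Rightarrow> real" where
  "weighted_integral v S f =
     (LINT p:fund S|lborel. f p * exp (chart S p \<bullet> v) * sqrt (det (first_form S p)))"

text \<open>The second variation \<open>\<integral> (|\<nabla>u|\<^sup>2 - |A|\<^sup>2 u\<^sup>2) dA\<^sub>\<phi>\<close> of the weighted area
  at a field with normal component \<open>u\<close> vanishing on the boundary.\<close>

definition Q_form :: "real^3 \<Rightarrow> psurface \<Rightarrow> (real^3 \<Rightarrow> real) \<Rightarrow> real" where
  "Q_form v S u =
     weighted_integral v S (\<lambda>p. sq_norm_grad S u p - sq_norm_A S p * (u (chart S p))\<^sup>2)"

definition stable :: "real^3 \<Rightarrow> psurface \<Rightarrow> bool" where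
  "stable v S \<longleftrightarrow>
     (\<forall>u. smooth_near (points S) u \<and> (\<forall>x\<in>bdry S. u x = 0) \<and>
          weighted_integral v S (\<lambda>p. u (chart S p)) = 0 \<longrightarrow> Q_form v S u \<ge> 0)"

definition unstable_translating_soliton :: "real^3 \<Rightarrow> real \<Rightarrow> psurface \<Rightarrow> bool" where
  "unstable_translating_soliton v lam S \<longleftrightarrow> translating_soliton v lam S \<and> \<not> stable v S"

text \<open>The piece \<open>C\<^sub>r(L)\<close> of the circular cylinder, with its inward normal.\<close>

definition cylinder_piece :: "real \<Rightarrow> real \<Rightarrow> psurface" where
  "cylinder_piece r L =
     \<lparr> chart = (\<lambda>(s, t). vector [r * cos (s / r), r * sin (s / r), t]),
       region = UNIV \<times> {0..L},
       fund = {0..<2 * pi * r} \<times> {0..L},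
       gauss = (\<lambda>x. vector [- (x $ 1) / r, - (x $ 2) / r, 0]) \<rparr>"

end

theory Submission
  imports Defs
begin

text \<open>
  Instability is witnessed by the rotationally symmetric function \<open>u(x) = exp (- x\<^sub>3) sin (w x\<^sub>3)\<close>
  with \<open>w = 2\<pi>/L\<close>. It vanishes on both boundary circles, and the factor \<open>exp (- x\<^sub>3)\<close> cancels the
  weight, so that its weighted mean is the integral of a sine over a full period, hence zero.
  On the cylinder \<open>|A|\<^sup>2 = 1/r\<^sup>2\<close>, and with \<open>S = sin (w t)\<close> and \<open>C = cos (w t)\<close> the second variation is
  \<open>2\<pi>r\<close> times the integral over \<open>[0, L]\<close> of
  \<open>exp (- t) ((w C - S)\<^sup>2 - S\<^sup>2/r\<^sup>2)\<close>. Since \<open>exp (- t) (2 w S C - S\<^sup>2)\<close> is the derivative of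
  \<open>exp (- t) S\<^sup>2\<close>, which vanishes at both ends, only \<open>exp (- t) (w\<^sup>2 C\<^sup>2 - S\<^sup>2/r\<^sup>2)\<close> matters, and an
  elementary integration gives
  \<open>2\<pi>r (1 - exp (- L)) w\<^sup>2 (1 + 2 w\<^sup>2 - 2/r\<^sup>2) / (1 + 4 w\<^sup>2)\<close>.
  This is negative exactly when \<open>w\<^sup>2 < 1/r\<^sup>2 - 1/2\<close>, that is, when \<open>L > \<surd>8 \<pi> r / \<surd>(2 - r\<^sup>2)\<close>
  (lemma \<open>cylinder_unstable\<close>).

  It also has to be shown that the cylinder piece is a compact embedded translating soliton
  (\<open>cylinder_translating_soliton\<close>). Its chart is a local isometry of the strip, so the first
  fundamental form is the identity and all curvature quantities are read off directly
  (\<open>cylinder_curvature\<close>). The delicate part of embeddedness is that the chart is open onto its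
  image; this follows from local angle functions built from the complex logarithm
  (\<open>cylinder_chart_open_map\<close>).
\<close>

section \<open>Smooth families of functions\<close>

text \<open>The maps of this proof lie in finite-dimensional families that directional differentiation
  maps into themselves. For such a family smoothness follows from a single
  first-order computation, without any product or chain rule for iterated derivatives.\<close>

lemma Ck_on_closed_family:
  assumes "f \<in> F"
    and diff: "\<And>f x. f \<in> F \<Longrightarrow> f differentiable at x"
    and closed: "\<And>f b. f \<in> F \<Longrightarrow> b \<in> Basis \<Longrightarrow> (\<lambda>x. frechet_derivative f (at x) b) \<in> F"
  shows "Ck_on k U f"
  using assms(1)
proof (induction k arbitrary: f)
  case 0
  have "continuous (at x within U) f" for x
    using diff[OF 0] differentiable_imp_continuous_within continuous_at_imp_continuous_within by blast
  then show ?case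
    by (simp add: continuous_on_eq_continuous_within)
next
  case (Suc k)
  then show ?case using diff closed by simp
qed

corollary smooth_near_closed_family:
  assumes "f \<in> F"
    and "\<And>f x. f \<in> F \<Longrightarrow> f differentiable at x"
    and "\<And>f b. f \<in> F \<Longrightarrow> b \<in> Basis \<Longrightarrow> (\<lambda>x. frechet_derivative f (at x) b) \<in> F"
  shows "smooth_near M f"
  unfolding smooth_near_def using Ck_on_closed_family[OF assms] by blast

lemma smooth_near_bounded_linear:
  fixes f :: "'a::euclidean_space \<Rightarrow> 'b::real_normed_vector"
  assumes "bounded_linear f"
  shows "smooth_near M f"
proof (rule smooth_near_closed_family)
  \<comment> \<open>The derivatives of a linear map are constants, so these have to be added to the family.\<close>
  let ?F = "{f :: 'a \<Rightarrow> 'b. bounded_linear f} \<union> range (\<lambda>c x. c)"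
  show "f \<in> ?F" using assms by simp
  show "g differentiable at x" if "g \<in> ?F" for g x
    using that by (auto intro: bounded_linear_imp_differentiable)
  show "(\<lambda>x. frechet_derivative g (at x) b) \<in> ?F" if "g \<in> ?F" for g b
  proof -
    have "frechet_derivative g (at x) b = g b" if "bounded_linear g" for x
      using frechet_derivative_at[OF bounded_linear_imp_has_derivative[OF that]] by metis
    then show ?thesis using that by (auto simp: frechet_derivative_const)
  qed
qed

text \<open>The cylinder chart and its composition with the Gauss map are both of the following form. The
  translation part \<open>W\<close> makes the family closed under differentiation, where the derivative of
  the linear term reappears as a constant.\<close>

definition screw_map :: "real \<Rightarrow> 'v \<Rightarrow> 'v \<Rightarrow> 'v \<Rightarrow> 'v \<Rightarrow> real \<times> real \<Rightarrow> 'v::real_normed_vector" where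
  "screw_map r P Q V W p = cos (fst p / r) *\<^sub>R P + sin (fst p / r) *\<^sub>R Q + snd p *\<^sub>R V + W"

lemma frechet_derivative_screw_map:
  shows "frechet_derivative (screw_map r P Q V W) (at p) h =
     fst h *\<^sub>R ((- sin (fst p / r) / r) *\<^sub>R P + (cos (fst p / r) / r) *\<^sub>R Q) + snd h *\<^sub>R V"
    and differentiable_screw_map: "screw_map r P Q V W differentiable at p"
proof -
  have D: "(screw_map r P Q V W has_derivative
     (\<lambda>h. fst h *\<^sub>R ((- sin (fst p / r) / r) *\<^sub>R P + (cos (fst p / r) / r) *\<^sub>R Q) + snd h *\<^sub>R V)) (at p)"
    unfolding screw_map_def
    by (auto intro!: derivative_eq_intros simp: algebra_simps divide_inverse)
  then show "frechet_derivative (screw_map r P Q V W) (at p) h =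
     fst h *\<^sub>R ((- sin (fst p / r) / r) *\<^sub>R P + (cos (fst p / r) / r) *\<^sub>R Q) + snd h *\<^sub>R V"
    using frechet_derivative_at[OF D] by metis
  show "screw_map r P Q V W differentiable at p" using D unfolding differentiable_def by blast
qed

lemma pd_screw_map:
  "pd 1 (screw_map r P Q V W) p = (- sin (fst p / r) / r) *\<^sub>R P + (cos (fst p / r) / r) *\<^sub>R Q"
  "pd 2 (screw_map r P Q V W) p = V"
  by (simp_all add: pd_def frechet_derivative_screw_map)

lemma smooth_near_screw_map: "smooth_near M (screw_map r P Q V W)"
proof (rule smooth_near_closed_family)
  let ?F = "{f. \<exists>P Q V W. f = screw_map r P Q V W}"
  show "screw_map r P Q V W \<in> ?F" by blast
  show "f differentiable at x" if "f \<in> ?F" for f x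
    using that differentiable_screw_map by blast
  show "(\<lambda>x. frechet_derivative f (at x) b) \<in> ?F" if f: "f \<in> ?F" for f and b :: "real \<times> real"
  proof -
    obtain P Q V W where f: "f = screw_map r P Q V W" using f by blast
    have "(\<lambda>x. frechet_derivative f (at x) b)
        = screw_map r ((fst b / r) *\<^sub>R Q) ((- fst b / r) *\<^sub>R P) 0 (snd b *\<^sub>R V)"
      unfolding f frechet_derivative_screw_map by (rule ext) (simp add: screw_map_def algebra_simps)
    then show ?thesis by blast
  qed
qed

text \<open>The damped oscillations of frequency \<open>w\<close> form a plane invariant under differentiation that
  contains the test function \<open>exp (- t) sin (w t)\<close> as \<open>damped w 1 0\<close>.\<close>

definition damped :: "real \<Rightarrow> real \<Rightarrow> real \<Rightarrow> real \<Rightarrow> real" where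
  "damped w a b t = exp (- t) * (a * sin (w * t) + b * cos (w * t))"

lemma has_derivative_damped:
  "((\<lambda>x::real^3. damped w a b (x $ 3)) has_derivative
     (\<lambda>h. h $ 3 * damped w (- a - w * b) (w * a - b) (x $ 3))) (at x)"
  unfolding damped_def
  by (auto intro!: derivative_eq_intros bounded_linear_imp_has_derivative
      bounded_linear_vec_nth simp: algebra_simps)

lemma smooth_near_damped: "smooth_near M (\<lambda>x::real^3. damped w a b (x $ 3))"
proof (rule smooth_near_closed_family)
  let ?F = "{f. \<exists>a b. f = (\<lambda>x::real^3. damped w a b (x $ 3))}"
  show "(\<lambda>x. damped w a b (x $ 3)) \<in> ?F" by blast
  show "f differentiable at x" if "f \<in> ?F" for f x
    using that has_derivative_damped unfolding differentiable_def by blast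
  show "(\<lambda>x. frechet_derivative f (at x) h) \<in> ?F" if f: "f \<in> ?F" for f h
  proof -
    obtain a b where f: "f = (\<lambda>x::real^3. damped w a b (x $ 3))" using f by blast
    have "(\<lambda>x. frechet_derivative f (at x) h)
        = (\<lambda>x. damped w (h $ 3 * (- a - w * b)) (h $ 3 * (w * a - b)) (x $ 3))"
      unfolding f frechet_derivative_at[OF has_derivative_damped, symmetric]
      by (rule ext) (simp add: damped_def algebra_simps)
    then show ?thesis by blast
  qed
qed

section \<open>The geometry of the cylinder\<close>

lemma cylinder_chart:
  "chart (cylinder_piece r L) = screw_map r (r *\<^sub>R axis 1 1) (r *\<^sub>R axis 2 1) (axis 3 1) 0"
  by (auto simp: cylinder_piece_def screw_map_def fun_eq_iff vec_eq_iff forall_3 axis_def)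

lemma cylinder_chart_nth:
  "chart (cylinder_piece r L) p $ 1 = r * cos (fst p / r)"
  "chart (cylinder_piece r L) p $ 2 = r * sin (fst p / r)"
  "chart (cylinder_piece r L) p $ 3 = snd p"
  by (auto simp: cylinder_chart screw_map_def axis_def)

lemma cylinder_region: "region (cylinder_piece r L) = UNIV \<times> {0..L}"
  and cylinder_fund: "fund (cylinder_piece r L) = {0..<2 * pi * r} \<times> {0..L}"
  and cylinder_gauss: "gauss (cylinder_piece r L) x = vector [- (x $ 1) / r, - (x $ 2) / r, 0]"
  by (auto simp: cylinder_piece_def)

lemma cylinder_gauss_chart:
  assumes "r > 0"
  shows "gauss (cylinder_piece r L) \<circ> chart (cylinder_piece r L)
    = screw_map r (- axis 1 1) (- axis 2 1) 0 0"
  using assms by (auto simp: cylinder_gauss cylinder_chart_nth screw_map_def fun_eq_iff vec_eq_iff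
      forall_3 axis_def)

lemma cylinder_first_form:
  assumes "r > 0"
  shows "first_form (cylinder_piece r L) p = mat 1"
  using assms sin_cos_squared_add3[of "fst p / r"]
  by (auto simp: first_form_def vec_eq_iff forall_2 cylinder_chart pd_screw_map mat_def
      inner_vec_def sum_3 axis_def power2_eq_square add.commute)

lemma cylinder_second_form:
  assumes "r > 0"
  shows "second_form (cylinder_piece r L) p = (\<chi> i j. if i = 1 \<and> j = 1 then 1 / r else 0)"
  using assms sin_cos_squared_add3[of "fst p / r"]
  unfolding second_form_def cylinder_gauss_chart[OF assms]
  unfolding cylinder_chart
  by (auto simp: vec_eq_iff forall_2 pd_screw_map inner_vec_def sum_3 axis_def field_simps)

lemma matrix_inv_mat_1: "matrix_inv (mat 1 :: real^'n^'n) = mat 1"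
  unfolding matrix_inv_def by (rule some_equality) auto

lemma cylinder_curvature:
  assumes "r > 0"
  shows "mean_curv (cylinder_piece r L) p = 1 / r"
    and "sq_norm_A (cylinder_piece r L) p = 1 / r\<^sup>2"
proof -
  have S: "shape_op (cylinder_piece r L) p = (\<chi> i j. if i = 1 \<and> j = 1 then 1 / r else 0)"
    using assms by (simp add: shape_op_def matrix_inv_mat_1 cylinder_first_form cylinder_second_form)
  show "mean_curv (cylinder_piece r L) p = 1 / r"
    by (simp add: mean_curv_def S trace_def sum_2)
  show "sq_norm_A (cylinder_piece r L) p = 1 / r\<^sup>2"
    by (simp add: sq_norm_A_def S trace_def sum_2 matrix_matrix_mult_def power2_eq_square)
qed

lemma cylinder_sq_norm_grad:
  assumes "r > 0" and f: "(f has_real_derivative f') (at (snd p))"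
  shows "sq_norm_grad (cylinder_piece r L) (\<lambda>x. f (x $ 3)) p = f'\<^sup>2"
proof -
  have e: "(\<lambda>x. f (x $ 3)) \<circ> chart (cylinder_piece r L) = (\<lambda>p. f (snd p))"
    by (auto simp: cylinder_chart_nth)
  have "((\<lambda>p. f (snd p)) has_derivative (\<lambda>h. f' * snd h)) (at p)"
    using has_derivative_compose[OF has_derivative_snd[OF has_derivative_ident]
        f[unfolded has_field_derivative_def]]
    by simp
  then have "frechet_derivative (\<lambda>p. f (snd p)) (at p) = (\<lambda>h. f' * snd h)"
    by (metis frechet_derivative_at)
  then have "pd 1 (\<lambda>p. f (snd p)) p = 0" "pd 2 (\<lambda>p. f (snd p)) p = f'"
    by (simp_all add: pd_def)
  then show ?thesis
    using assms unfolding sq_norm_grad_def e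
    by (simp add: cylinder_first_form matrix_inv_mat_1 inner_vec_def sum_2 power2_eq_square)
qed

section \<open>Embeddedness\<close>

lemma cylinder_points:
  assumes "r > 0"
  shows "chart (cylinder_piece r L) ` ({0..<2 * pi * r} \<times> {0..L})
      = {x. (x $ 1)\<^sup>2 + (x $ 2)\<^sup>2 = r\<^sup>2 \<and> x $ 3 \<in> {0..L}}"
    and "points (cylinder_piece r L) = {x. (x $ 1)\<^sup>2 + (x $ 2)\<^sup>2 = r\<^sup>2 \<and> x $ 3 \<in> {0..L}}"
proof -
  let ?X = "{x :: real^3. (x $ 1)\<^sup>2 + (x $ 2)\<^sup>2 = r\<^sup>2 \<and> x $ 3 \<in> {0..L}}"
  let ?c = "chart (cylinder_piece r L)"
  have 1: "?c ` (UNIV \<times> {0..L}) \<subseteq> ?X"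
    by (auto simp: cylinder_chart_nth power_mult_distrib simp flip: distrib_left)
  have 2: "?X \<subseteq> ?c ` ({0..<2 * pi * r} \<times> {0..L})"
  proof
    fix x :: "real^3" assume x: "x \<in> ?X"
    have "(x $ 1 / r)\<^sup>2 + (x $ 2 / r)\<^sup>2 = 1"
      using x assms by (simp add: power_divide flip: add_divide_distrib)
    then obtain \<theta> where \<theta>: "0 \<le> \<theta>" "\<theta> < 2 * pi" "x $ 1 / r = cos \<theta>" "x $ 2 / r = sin \<theta>"
      using sincos_total_2pi by metis
    have "x = ?c (\<theta> * r, x $ 3)"
      using \<theta> assms by (auto simp: vec_eq_iff forall_3 cylinder_chart_nth field_simps)
    moreover have "(\<theta> * r, x $ 3) \<in> {0..<2 * pi * r} \<times> {0..L}"
      using \<theta> x assms by simp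
    ultimately show "x \<in> ?c ` ({0..<2 * pi * r} \<times> {0..L})" by blast
  qed
  have 3: "?c ` ({0..<2 * pi * r} \<times> {0..L}) \<subseteq> ?c ` (UNIV \<times> {0..L})" by blast
  show "?c ` ({0..<2 * pi * r} \<times> {0..L}) = ?X" using 1 2 3 by blast
  show "points (cylinder_piece r L) = ?X"
    unfolding points_def cylinder_region using 1 2 3 by blast
qed

text \<open>The strip is not compact, but by periodicity the closed rectangle over one period already
  covers the surface.\<close>

lemma compact_cylinder_points:
  assumes "r > 0"
  shows "compact (points (cylinder_piece r L))"
proof -
  let ?c = "chart (cylinder_piece r L)"
  have "?c ` ({0..2 * pi * r} \<times> {0..L}) \<subseteq> ?c ` (UNIV \<times> {0..L})" by blast
  moreover have "?c ` ({0..<2 * pi * r} \<times> {0..L}) \<subseteq> ?c ` ({0..2 * pi * r} \<times> {0..L})" by auto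
  ultimately have eq: "points (cylinder_piece r L) = ?c ` ({0..2 * pi * r} \<times> {0..L})"
    using cylinder_points[OF assms, of L] by (auto simp: points_def cylinder_region)
  have "continuous_on ({0..2 * pi * r} \<times> {0..L}) ?c"
    unfolding cylinder_chart screw_map_def divide_inverse by (intro continuous_intros)
  then show ?thesis
    unfolding eq by (intro compact_continuous_image compact_Times compact_Icc)
qed

lemma cylinder_chart_inj_on_fund:
  assumes "r > 0"
  shows "inj_on (chart (cylinder_piece r L)) (fund (cylinder_piece r L))"
proof (rule inj_onI)
  fix p q assume p: "p \<in> fund (cylinder_piece r L)" and q: "q \<in> fund (cylinder_piece r L)"
    and eq: "chart (cylinder_piece r L) p = chart (cylinder_piece r L) q"
  have "cis (fst p / r) = cis (fst q / r)"
    using arg_cong[OF eq, of "\<lambda>x. x $ 1"] arg_cong[OF eq, of "\<lambda>x. x $ 2"] assms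
    by (simp add: cylinder_chart_nth complex_eq_iff)
  moreover have "0 \<le> fst p / r" "fst p / r < 2 * pi" "0 \<le> fst q / r" "fst q / r < 2 * pi"
    using p q assms by (auto simp: cylinder_fund field_simps)
  ultimately have "fst p / r = fst q / r"
    by (metis Arg2pi_unique cis_conv_exp less_numeral_extra(1) mult_1 of_real_1)
  then show "p = q"
    using assms arg_cong[OF eq, of "\<lambda>x. x $ 3"] by (simp add: cylinder_chart_nth prod_eq_iff)
qed

text \<open>Near a point with coordinates \<open>(s, t)\<close> the chart has a continuous right inverse: after
  rotation by \<open>- s/r\<close> the point has angle zero, so the imaginary part of the principal logarithm
  is a continuous angle there, and it recovers the first coordinate. The points whose recovered
  coordinates lie in a given open set form an open set.\<close>

lemma cylinder_chart_open_map:
  assumes r: "r > 0"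
  shows "open_map (top_of_set (region (cylinder_piece r L))) (top_of_set (points (cylinder_piece r L)))
     (chart (cylinder_piece r L))"
  unfolding open_map_def
proof (intro allI impI)
  fix O' assume "openin (top_of_set (region (cylinder_piece r L))) O'"
  then obtain W where W: "open W" and O': "O' = (UNIV \<times> {0..L}) \<inter> W"
    by (auto simp: openin_open cylinder_region)
  let ?c = "chart (cylinder_piece r L)" and ?M = "points (cylinder_piece r L)"
  show "openin (top_of_set ?M) (?c ` O')"
  proof (subst openin_subopen, intro ballI)
    fix x assume "x \<in> ?c ` O'"
    then obtain s t where st: "(s, t) \<in> W" "t \<in> {0..L}" and x: "x = ?c (s, t)"
      unfolding O' by auto
    \<comment> \<open>\<open>z\<close> is the rotated position in the plane, scaled to the unit circle; \<open>\<sigma>\<close> is the local inverse.\<close>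
    define z where "z y = (Complex (y $ 1) (y $ 2) / r) * cis (- (s / r))" for y :: "real^3"
    define \<sigma> where "\<sigma> y = (s + r * Im (Ln (z y)), y $ 3)" for y
    have cz: "continuous_on UNIV z"
      unfolding z_def Complex_eq divide_inverse by (intro continuous_intros)
    let ?D = "z -` (- \<real>\<^sub>\<le>\<^sub>0)"
    have oD: "open ?D"
      using cz by (intro open_vimage) (auto simp: closed_nonpos_Reals_complex open_Compl)
    have "continuous_on ?D \<sigma>"
      unfolding \<sigma>_def using continuous_on_subset[OF cz]
      by (intro continuous_intros) auto
    then have oV: "open (?D \<inter> \<sigma> -` W)"
      using oD W by (simp add: continuous_on_open_vimage Int_commute)
    have zx: "z x = 1"
      using r by (simp add: z_def x cylinder_chart_nth complex_eq_iff power2_eq_square field_simps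
          flip: distrib_left)
    have "x \<in> ?M \<inter> (?D \<inter> \<sigma> -` W)"
      using zx st x by (auto simp: \<sigma>_def cylinder_chart_nth points_def cylinder_region)
    moreover have "?M \<inter> (?D \<inter> \<sigma> -` W) \<subseteq> ?c ` O'"
    proof
      fix y assume y: "y \<in> ?M \<inter> (?D \<inter> \<sigma> -` W)"
      then obtain s' t' where y': "y = ?c (s', t')" "t' \<in> {0..L}"
        by (auto simp: points_def cylinder_region)
      have yz: "z y = cis (s' / r) * cis (- (s / r))"
        using r by (simp add: z_def y' cylinder_chart_nth complex_eq_iff) (simp add: field_simps)
      then have nz: "norm (z y) = 1" by (simp add: norm_mult)
      have "cis (fst (\<sigma> y) / r) = cis (s / r) * cis (Im (Ln (z y)))"
        using r by (simp add: \<sigma>_def cis_mult add_divide_distrib)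
      also have "cis (Im (Ln (z y))) = z y"
      proof -
        have "z y \<noteq> 0" using nz by auto
        then have "z y = exp (Ln (z y))" by simp
        also have "\<dots> = exp (Re (Ln (z y))) * cis (Im (Ln (z y)))" by (simp add: exp_eq_polar)
        finally show ?thesis using nz \<open>z y \<noteq> 0\<close> by simp
      qed
      also have "cis (s / r) * z y = cis (s' / r)" by (simp add: yz cis_mult)
      finally have "cos (fst (\<sigma> y) / r) = cos (s' / r)" "sin (fst (\<sigma> y) / r) = sin (s' / r)"
        by (simp_all add: complex_eq_iff)
      then have "y = ?c (\<sigma> y)"
        by (simp add: y' vec_eq_iff forall_3 cylinder_chart_nth \<sigma>_def)
      moreover have "\<sigma> y \<in> O'"
        using y y' by (auto simp: O' \<sigma>_def cylinder_chart_nth)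
      ultimately show "y \<in> ?c ` O'" by blast
    qed
    ultimately show "\<exists>T. openin (top_of_set ?M) T \<and> x \<in> T \<and> T \<subseteq> ?c ` O'"
      using oV by (intro exI[of _ "?M \<inter> (?D \<inter> \<sigma> -` W)"]) (auto simp: openin_open)
  qed
qed

lemma cylinder_compact_surface:
  assumes "r > 0" "L > 0"
  shows "compact_surface (cylinder_piece r L)"
  unfolding compact_surface_def
proof (intro conjI ballI allI)
  let ?S = "cylinder_piece r L"
  show "closed (region ?S)" by (simp add: cylinder_region closed_Times)
  show "region ?S \<subseteq> closure (interior (region ?S))"
    using assms by (simp add: cylinder_region interior_Times closure_Times)
  show "smooth_near (region ?S) (chart ?S)"
    by (simp add: cylinder_chart smooth_near_screw_map)
  show "det (first_form ?S p) \<noteq> 0" for p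
    using assms by (simp add: cylinder_first_form)
  show "open_map (top_of_set (region ?S)) (top_of_set (points ?S)) (chart ?S)"
    using assms by (simp add: cylinder_chart_open_map)
  show "compact (points ?S)"
    using assms by (simp add: compact_cylinder_points)
  show "fund ?S \<in> sets borel"
    unfolding cylinder_fund by (intro borel_Times) auto
  show "fund ?S \<subseteq> region ?S" by (auto simp: cylinder_fund cylinder_region)
  show "inj_on (chart ?S) (fund ?S)" using assms by (simp add: cylinder_chart_inj_on_fund)
  show "chart ?S ` fund ?S = points ?S"
    using assms by (simp add: cylinder_fund cylinder_points)
  have "linear (gauss ?S)"
    by (intro linearI) (auto simp: cylinder_gauss vec_eq_iff forall_3 diff_divide_distrib)
  then show "smooth_near (points ?S) (gauss ?S)"
    by (intro smooth_near_bounded_linear) (simp add: linear_conv_bounded_linear)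
  fix p
  have N: "gauss ?S (chart ?S p) = screw_map r (- axis 1 1) (- axis 2 1) 0 0 p"
    using fun_cong[OF cylinder_gauss_chart[OF assms(1), of L], of p] by simp
  show "norm (gauss ?S (chart ?S p)) = 1"
    unfolding N by (simp add: norm_eq_1 inner_vec_def sum_3 screw_map_def axis_def flip: power2_eq_square)
  show "gauss ?S (chart ?S p) \<bullet> pd i (chart ?S) p = 0" for i
    using exhaust_2[of i] assms unfolding N
    by (auto simp: cylinder_chart pd_screw_map inner_vec_def sum_3 screw_map_def axis_def)
qed

lemma cylinder_translating_soliton:
  assumes "r > 0" "L > 0"
  shows "translating_soliton (vector [0, 0, 1]) (1 / r) (cylinder_piece r L)"
  using assms unfolding translating_soliton_def
  by (auto simp: cylinder_compact_surface cylinder_curvature cylinder_gauss inner_vec_def sum_3)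

section \<open>The second variation\<close>

text \<open>For functions of the height, Fubini splits off the circumference \<open>2\<pi>r\<close>; what remains is
  evaluated by an antiderivative of the weighted integrand.\<close>

lemma cylinder_weighted_integral:
  assumes r: "r > 0" and L: "L \<ge> 0"
    and cont: "continuous_on {0..L} g"
    and F: "\<And>t. 0 \<le> t \<Longrightarrow> t \<le> L \<Longrightarrow> (F has_real_derivative g t * exp t) (at t)"
  shows "weighted_integral (vector [0, 0, 1]) (cylinder_piece r L) (\<lambda>p. g (snd p))
    = 2 * pi * r * (F L - F 0)"
proof -
  let ?A = "{0..<2 * pi * r}" and ?B = "{0..L}"
  let ?h = "\<lambda>t. g t * exp t"
  have ch: "continuous_on ?B ?h" by (intro continuous_intros cont)
  have "set_integrable lborel (?A \<times> ?B) (\<lambda>p. ?h (snd p))"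
  proof (rule set_integrable_subset)
    show "set_integrable lborel ({0..2 * pi * r} \<times> ?B) (\<lambda>p. ?h (snd p))"
      unfolding set_integrable_def
      by (intro borel_integrable_compact compact_Times compact_Icc continuous_on_compose2[OF ch]
          continuous_intros) auto
    show "?A \<times> ?B \<in> sets lborel" by (simp, intro borel_Times) auto
  qed auto
  then have int: "integrable (lborel \<Otimes>\<^sub>M lborel)
      (\<lambda>(s, t). indicat_real ?A s * (indicat_real ?B t * ?h t))"
    unfolding set_integrable_def lborel_prod
    by (rule back_subst[of "integrable lborel"]) (auto simp: fun_eq_iff indicator_def)
  have "weighted_integral (vector [0, 0, 1]) (cylinder_piece r L) (\<lambda>p. g (snd p))
      = integral\<^sup>L (lborel \<Otimes>\<^sub>M lborel) (\<lambda>(s, t). indicat_real ?A s * (indicat_real ?B t * ?h t))"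
    unfolding weighted_integral_def set_lebesgue_integral_def lborel_prod
    using r by (intro Bochner_Integration.integral_cong)
      (auto simp: cylinder_fund cylinder_first_form inner_vec_def sum_3 cylinder_chart_nth indicator_def)
  also have "\<dots> = (LINT s|lborel. indicat_real ?A s * (LINT t|lborel. indicat_real ?B t * ?h t))"
    using lborel_pair.integral_fst'[OF int] by simp
  also have "\<dots> = 2 * pi * r * (LINT t|lborel. indicat_real ?B t * ?h t)"
    using r by simp
  also have "(LINT t|lborel. indicat_real ?B t * ?h t) = F L - F 0"
  proof -
    have "(LINT t|lborel. indicat_real ?B t *\<^sub>R ?h t) = F L - F 0"
      using L F ch by (intro integral_FTC_atLeastAtMost)
        (auto simp: has_real_derivative_iff_has_vector_derivative intro: has_vector_derivative_at_within)
    then show ?thesis by simp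
  qed
  finally show ?thesis .
qed

text \<open>The choice \<open>w = 2\<pi>/L\<close> is the smallest positive frequency for which the test function vanishes on the
  boundary and has mean zero; the bound on \<open>w\<^sup>2\<close> is equivalent to the negativity of the second
  variation.\<close>

lemma cylinder_unstable:
  assumes r: "r > 0" and L: "L > 0" and w: "w = 2 * pi / L" and small: "w\<^sup>2 < 1 / r\<^sup>2 - 1 / 2"
  shows "\<not> stable (vector [0, 0, 1]) (cylinder_piece r L)"
proof
  let ?S = "cylinder_piece r L" and ?v = "vector [0, 0, 1] :: real^3"
  define u where "u x = damped w 1 0 (x $ 3)" for x :: "real^3"
  assume st: "stable ?v ?S"
  have wL: "w * L = 2 * pi" and w0: "w \<noteq> 0" using w L by auto
  have bd: "u x = 0" if x: "x \<in> bdry ?S" for x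
  proof -
    have "frontier (region ?S) \<subseteq> UNIV \<times> {0, L}"
      using L by (auto simp: frontier_def cylinder_region interior_Times closure_Times)
    then have "x $ 3 = 0 \<or> x $ 3 = L"
      using x by (auto simp: bdry_def cylinder_chart_nth)
    then show ?thesis using wL by (elim disjE) (simp_all add: u_def damped_def)
  qed
  have mean: "weighted_integral ?v ?S (\<lambda>p. u (chart ?S p)) = 0"
  proof -
    have "((\<lambda>t. - cos (w * t) / w) has_real_derivative damped w 1 0 t * exp t) (at t)" for t
      using w0 by (auto intro!: derivative_eq_intros simp: damped_def exp_minus)
    then have "weighted_integral ?v ?S (\<lambda>p. damped w 1 0 (snd p))
        = 2 * pi * r * (- cos (w * L) / w - (- cos (w * 0) / w))"
      using r L by (intro cylinder_weighted_integral) (auto simp: damped_def intro!: continuous_intros)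
    then show ?thesis by (simp add: u_def cylinder_chart_nth wL)
  qed
  have "smooth_near (points ?S) u" unfolding u_def by (rule smooth_near_damped)
  then have pos: "Q_form ?v ?S u \<ge> 0" using st bd mean unfolding stable_def by blast
  define g where "g t = (damped w (-1) w t)\<^sup>2 - 1 / r\<^sup>2 * (damped w 1 0 t)\<^sup>2" for t
  \<comment> \<open>With \<open>S\<close> and \<open>C\<close> for the sine and cosine of \<open>w t\<close>, the weighted integrand is
    \<open>exp (- t) (w\<^sup>2 - c S\<^sup>2) + exp (- t) (S\<^sup>2 - 2 w S C)\<close>. The second summand has antiderivative
    \<open>- exp (- t) S\<^sup>2\<close>, and \<open>exp (- t) S\<^sup>2\<close> has antiderivative
    \<open>- exp (- t) (2 w\<^sup>2 + 2 w S C + S\<^sup>2) / (1 + 4 w\<^sup>2)\<close>; together they make up \<open>F\<close>.\<close>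
  define c where "c = w\<^sup>2 + 1 / r\<^sup>2"
  define F where "F t = - exp (- t) * (w\<^sup>2 + (sin (w * t))\<^sup>2
      - c * (2 * w\<^sup>2 + 2 * w * sin (w * t) * cos (w * t) + (sin (w * t))\<^sup>2) / (1 + 4 * w\<^sup>2))" for t
  have "(damped w 1 0 has_real_derivative damped w (-1) w t) (at t)" for t
    unfolding damped_def[abs_def] by (auto intro!: derivative_eq_intros simp: algebra_simps)
  then have grad: "sq_norm_grad ?S u p = (damped w (-1) w (snd p))\<^sup>2" for p
    unfolding u_def by (intro cylinder_sq_norm_grad r)
  have "Q_form ?v ?S u = weighted_integral ?v ?S (\<lambda>p. g (snd p))"
    unfolding Q_form_def using r by (simp add: g_def grad cylinder_curvature u_def cylinder_chart_nth)
  also have "\<dots> = 2 * pi * r * (F L - F 0)"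
  proof (rule cylinder_weighted_integral)
    show "continuous_on {0..L} g"
      unfolding g_def damped_def by (intro continuous_intros)
    show "(F has_real_derivative g t * exp t) (at t)" for t
    proof -
      define S C E where "S = sin (w * t)" and "C = cos (w * t)" and "E = exp (- t)"
      have SC: "C\<^sup>2 = 1 - S\<^sup>2" by (simp add: S_def C_def cos_squared_eq)
      have k: "1 + 4 * w\<^sup>2 \<noteq> 0" by (smt (verit) zero_le_power2)
      have "(F has_real_derivative
          E * (w\<^sup>2 + S\<^sup>2 - c * (2 * w\<^sup>2 + 2 * w * S * C + S\<^sup>2) / (1 + 4 * w\<^sup>2))
          - E * (2 * w * S * C - c * (2 * w\<^sup>2 * (C\<^sup>2 - S\<^sup>2) + 2 * w * S * C) / (1 + 4 * w\<^sup>2))) (at t)"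
        unfolding F_def S_def C_def E_def
        by (rule derivative_eq_intros refl k | simp)+
           (simp add: divide_inverse algebra_simps power2_eq_square)
      also have "E * (w\<^sup>2 + S\<^sup>2 - c * (2 * w\<^sup>2 + 2 * w * S * C + S\<^sup>2) / (1 + 4 * w\<^sup>2))
          - E * (2 * w * S * C - c * (2 * w\<^sup>2 * (C\<^sup>2 - S\<^sup>2) + 2 * w * S * C) / (1 + 4 * w\<^sup>2))
        = E * (w\<^sup>2 + S\<^sup>2 - 2 * w * S * C - c * ((2 * w\<^sup>2 + S\<^sup>2 - 2 * w\<^sup>2 * (C\<^sup>2 - S\<^sup>2)) / (1 + 4 * w\<^sup>2)))"
        by (simp add: divide_inverse algebra_simps)
      also have "(2 * w\<^sup>2 + S\<^sup>2 - 2 * w\<^sup>2 * (C\<^sup>2 - S\<^sup>2)) / (1 + 4 * w\<^sup>2) = S\<^sup>2"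
        using k by (simp add: SC field_simps)
      also have "E * (w\<^sup>2 + S\<^sup>2 - 2 * w * S * C - c * S\<^sup>2) = E * ((w * C - S)\<^sup>2 - S\<^sup>2 / r\<^sup>2)"
      proof -
        have "(w * C)\<^sup>2 = w\<^sup>2 * (1 - S\<^sup>2)" by (simp add: power_mult_distrib SC)
        then show ?thesis by (simp add: c_def power2_diff) (simp add: algebra_simps)
      qed
      also have "\<dots> = g t * exp t"
      proof -
        have "exp t * E = 1" by (simp add: E_def exp_minus)
        then show ?thesis
          unfolding g_def damped_def S_def[symmetric] C_def[symmetric] E_def[symmetric]
          by (simp add: power2_eq_square) algebra
      qed
      finally show ?thesis .
    qed
  qed (use r L in auto)
  also have "F L - F 0 = (1 - exp (- L)) * (w\<^sup>2 * (1 + 2 * w\<^sup>2 - 2 / r\<^sup>2) / (1 + 4 * w\<^sup>2))"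
  proof -
    have k: "1 + 4 * w\<^sup>2 \<noteq> 0" by (smt (verit) zero_le_power2)
    have "w\<^sup>2 - c * (2 * w\<^sup>2) / (1 + 4 * w\<^sup>2) = w\<^sup>2 * (1 + 2 * w\<^sup>2 - 2 / r\<^sup>2) / (1 + 4 * w\<^sup>2)"
    proof -
      have "w\<^sup>2 - c * (2 * w\<^sup>2) / (1 + 4 * w\<^sup>2) = (w\<^sup>2 * (1 + 4 * w\<^sup>2) - c * (2 * w\<^sup>2)) / (1 + 4 * w\<^sup>2)"
        using k by (simp add: diff_divide_distrib)
      then show ?thesis by (simp add: c_def algebra_simps)
    qed
    then have "F L - F 0 = - exp (- L) * (w\<^sup>2 * (1 + 2 * w\<^sup>2 - 2 / r\<^sup>2) / (1 + 4 * w\<^sup>2))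
        + w\<^sup>2 * (1 + 2 * w\<^sup>2 - 2 / r\<^sup>2) / (1 + 4 * w\<^sup>2)"
      by (simp add: F_def wL)
    then show ?thesis by (simp only: left_diff_distrib)
  qed
  also have "2 * pi * r * \<dots> < 0"
  proof -
    have "w\<^sup>2 * (1 + 2 * w\<^sup>2 - 2 / r\<^sup>2) / (1 + 4 * w\<^sup>2) < 0"
      using w0 small by (intro divide_neg_pos mult_pos_neg) (auto simp: add_pos_nonneg)
    moreover have "1 - exp (- L) > 0" using L by simp
    ultimately show ?thesis using r by (intro mult_pos_neg) auto
  qed
  finally show False using pos by simp
qed

theorem theorem5p1:
  fixes r L :: real
  assumes "0 < r" and "r < sqrt 2"
    and "L > sqrt 8 * pi * r / sqrt (2 - r\<^sup>2)"
  shows "unstable_translating_soliton (vector [0, 0, 1]) (1 / r) (cylinder_piece r L)"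
proof -
  have r2: "r\<^sup>2 < 2"
    using power_strict_mono[OF assms(2), of 2] assms(1) by simp
  have nonneg: "0 < sqrt 8 * pi * r / sqrt (2 - r\<^sup>2)" using assms r2 by simp
  then have L: "L > 0" using assms(3) by linarith
  have "(sqrt 8 * pi * r / sqrt (2 - r\<^sup>2))\<^sup>2 < L\<^sup>2"
    using assms(3) nonneg by (intro power_strict_mono) auto
  then have "8 * pi\<^sup>2 * r\<^sup>2 / (2 - r\<^sup>2) < L\<^sup>2"
    using r2 by (simp add: power_divide power_mult_distrib)
  then have "(2 * pi / L)\<^sup>2 < 1 / r\<^sup>2 - 1 / 2"
    using r2 L assms(1) by (simp add: power_divide power_mult_distrib field_simps)
  then show ?thesis
    unfolding unstable_translating_soliton_def
    using cylinder_translating_soliton cylinder_unstable assms(1) L by blast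
qed

end
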